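(* Let $n,f\ge1$ be integers, and suppose there is a $b$-bit vertex labeling scheme which, for every undirected graph $G$ on (at most) $O(n+fn^{1/f})$ vertices, assigns labels $L:V(G)\to\{0,1\}^b$ such that for every $F\subseteq V(G)$ with $|F|\le f$, a fixed decoder given only $\{L(v)\mid v\in F\}$ correctly reports whether $G-F$ is connected. Then $b=\Omega(n^{1-1/f}/f)$.
   Context: $G-F$ is the graph obtained from $G$ by deleting the vertices in $F$ and their incident edges. The decoder is a fixed function independent of $G$; the labels may depend on $G$ and $f$. *)

theory Defs
  imports Complex_Main "Graph_Theory.Digraph_Component"
begin

abbreviation delete_vertices :: "'a pair_pre_digraph \<Rightarrow> 'a set \<Rightarrow> ('a, 'a \<times> 'a) pre_digraph"
  where "delete_vertices G F \<equiv> with_proj G \<restriction> (pverts G - F)"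

(* Undirected graphs are the finite, loop-free, symmetric digraphs of the locale pair_graph;
   vertices are natural numbers, which covers every finite graph up to isomorphism.
   The decoder D is chosen before G, the labeling L after it.

   F is required to be nonempty: the label set of F = {} is {} for every graph, so no decoder
   could tell a connected G from a disconnected one, and with F = {} allowed no scheme exists
   as soon as graphs on two vertices are admitted. *)
definition connectivity_labeling_scheme :: "nat \<Rightarrow> nat \<Rightarrow> real \<Rightarrow> bool" where
  "connectivity_labeling_scheme b f N \<longleftrightarrow>
     (\<exists>D :: bool list set \<Rightarrow> bool.
        \<forall>G :: nat pair_pre_digraph. pair_graph G \<and> real (card (pverts G)) \<le> N \<longrightarrow>
          (\<exists>L :: nat \<Rightarrow> bool list.
             (\<forall>v \<in> pverts G. length (L v) = b) \<and>
             (\<forall>F. F \<subseteq> pverts G \<and> F \<noteq> {} \<and> card F \<le> f \<longrightarrow>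
                (D (L ` F) \<longleftrightarrow> connected (delete_vertices G F)))))"

end

(* A hub is joined to m ports, and to each member N j of an antichain of sets of ports belongs a
   leaf that is adjacent to the ports in N j and possibly to the hub as well. When the ports
   in N j fail, every other leaf keeps a port, so the rest is connected exactly if leaf j is
   adjacent to the hub. The labels of the ports thus encode one arbitrary bit for each of the
   n leaves, which forces b m >= n. Taking f groups of K = ceiling (n^(1/f)) ports and as sets
   N j transversals of the groups, of which there are K^f >= n, gives m = f K. *)

theory Submission
  imports Defs "HOL-Library.FuncSet"
begin

definition leaf_graph :: "nat \<Rightarrow> nat \<Rightarrow> (nat \<Rightarrow> nat set) \<Rightarrow> nat set \<Rightarrow> nat pair_pre_digraph" where
  \<comment> \<open>vertex 0 is the hub, 1, ..., m are the ports, and Suc (m + j) is leaf j\<close>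
  "leaf_graph m n N S =
     \<lparr> pverts = {..m + n},
       parcs = symcl ({0} \<times> {1..m} \<union> {0} \<times> (\<lambda>j. Suc (m + j)) ` S
                        \<union> (\<Union>j<n. {Suc (m + j)} \<times> N j)) \<rparr>"

lemma in_symcl_iff: "(u, v) \<in> symcl R \<longleftrightarrow> (u, v) \<in> R \<or> (v, u) \<in> R"
  by (auto simp: symcl_def)

lemma pair_graph_leaf_graph:
  assumes "\<And>j. j < n \<Longrightarrow> N j \<subseteq> {1..m}" and "S \<subseteq> {..<n}"
  shows "pair_graph (leaf_graph m n N S)" (is "pair_graph ?G")
proof -
  have arcs: "parcs ?G \<subseteq> pverts ?G \<times> pverts ?G"
    using assms by (force simp: leaf_graph_def in_symcl_iff)
  then have "finite (parcs ?G)"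
    by (rule finite_subset) (simp add: leaf_graph_def)
  moreover have "sym (parcs ?G)"
    by (auto simp: sym_def leaf_graph_def in_symcl_iff)
  moreover have "fst e \<noteq> snd e" if "e \<in> parcs ?G" for e
    using that assms(1) by (cases e) (force simp: leaf_graph_def in_symcl_iff)
  ultimately show ?thesis
    using arcs by unfold_locales (auto simp: symmetric_def leaf_graph_def)
qed

lemma arcs_ends_delete_vertices:
  "arcs_ends (delete_vertices G F) = parcs G \<inter> (pverts G - F) \<times> (pverts G - F)"
  by (auto simp: arcs_ends_conv)

text \<open>\<open>connected\<close> means reachability along the symmetric closure of the arcs.
  Hence a walk from \<open>u\<close> to \<open>r\<close> can be continued by the reverse of a walk
  from \<open>v\<close> to \<open>r\<close>. Walks of length at most two suffice here, since a leaf
  reaches the hub directly or through a surviving port.\<close>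

lemma connected_delete_vertices_hub:
  assumes "r \<in> pverts G - F"
    and hub: "\<And>u. u \<in> pverts G - F \<Longrightarrow> u \<noteq> r \<Longrightarrow>
           (u, r) \<in> parcs G \<or> (\<exists>w \<in> pverts G - F. (u, w) \<in> parcs G \<and> (w, r) \<in> parcs G)"
  shows "connected (delete_vertices G F)"
proof -
  let ?V = "pverts G - F"
  let ?R = "(arcs_ends (delete_vertices G F))\<^sup>s"
  have to_hub: "(u, r) \<in> rtrancl_on ?V ?R" if u: "u \<in> ?V" for u
  proof (cases "u = r")
    case True
    with u show ?thesis by simp
  next
    case False
    have step: "(x, y) \<in> ?R" if "(x, y) \<in> parcs G" "x \<in> ?V" "y \<in> ?V" for x y
      using that by (simp add: in_symcl_iff arcs_ends_delete_vertices)
    from hub[OF u False] show ?thesis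
    proof (elim disjE bexE conjE)
      assume "(u, r) \<in> parcs G"
      with u assms(1) show ?thesis
        by (meson step rtrancl_on_refl rtrancl_on_into_rtrancl_on)
    next
      fix w assume "w \<in> ?V" "(u, w) \<in> parcs G" "(w, r) \<in> parcs G"
      with u assms(1) show ?thesis
        by (meson step rtrancl_on_refl rtrancl_on_into_rtrancl_on)
    qed
  qed
  have "sym ?R"
    by (auto simp: sym_def in_symcl_iff)
  then have "sym (rtrancl_on ?V ?R)"
    by (rule rtrancl_on_sym)
  with to_hub have "(u, v) \<in> rtrancl_on ?V ?R" if "u \<in> ?V" "v \<in> ?V" for u v
    using that by (meson rtrancl_on_trans symE)
  with assms(1) show ?thesis
    unfolding connected_conv by auto
qed

text \<open>By induction along a walk that starts in \<open>u\<close>, the walk never leaves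
  \<open>u\<close>.\<close>

lemma not_connected_delete_vertices_isolated:
  assumes "u \<in> pverts G - F" "r \<in> pverts G - F" "u \<noteq> r"
    and isolated: "\<And>w. w \<in> pverts G - F \<Longrightarrow> (u, w) \<notin> parcs G \<and> (w, u) \<notin> parcs G"
  shows "\<not> connected (delete_vertices G F)"
proof
  let ?R = "(arcs_ends (delete_vertices G F))\<^sup>s"
  assume "connected (delete_vertices G F)"
  then have "(u, r) \<in> rtrancl_on (pverts G - F) ?R"
    using assms(1,2) by (auto simp: connected_conv)
  then have "r = u"
    by (rule rtrancl_on_induct)
      (use isolated in \<open>auto simp: in_symcl_iff arcs_ends_delete_vertices\<close>)
  with \<open>u \<noteq> r\<close> show False by simp
qed

lemma connected_leaf_graph_delete_iff:
  assumes N: "\<And>j. j < n \<Longrightarrow> N j \<subseteq> {1..m}" and S: "S \<subseteq> {..<n}" and j: "j < n"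
    and antichain: "\<And>i. i < n \<Longrightarrow> N i \<subseteq> N j \<Longrightarrow> i = j"
  shows "connected (delete_vertices (leaf_graph m n N S) (N j)) \<longleftrightarrow> j \<in> S"
    (is "connected (delete_vertices ?G _) \<longleftrightarrow> _")
proof -
  have hub: "0 \<in> pverts ?G - N j" and leaf: "Suc (m + j) \<in> pverts ?G - N j"
    using N[OF j] j by (auto simp: leaf_graph_def)
  show ?thesis
  proof
    assume "j \<in> S"
    show "connected (delete_vertices ?G (N j))"
    proof (rule connected_delete_vertices_hub[OF hub])
      fix u assume u: "u \<in> pverts ?G - N j" "u \<noteq> 0"
      show "(u, 0) \<in> parcs ?G \<or>
        (\<exists>w \<in> pverts ?G - N j. (u, w) \<in> parcs ?G \<and> (w, 0) \<in> parcs ?G)"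
      proof (cases "u \<le> m")
        case True
        with u show ?thesis by (simp add: leaf_graph_def in_symcl_iff)
      next
        case False
        define i where "i = u - Suc m"
        with False u have i: "i < n" "u = Suc (m + i)"
          by (auto simp: leaf_graph_def)
        show ?thesis
        proof (cases "i = j")
          case True
          with i \<open>j \<in> S\<close> show ?thesis by (auto simp: leaf_graph_def in_symcl_iff)
        next
          case False
          \<comment> \<open>As \<open>i\<close> differs from \<open>j\<close>, the antichain
            property leaves leaf \<open>i\<close> a port \<open>w\<close> that has not failed, and
            every port is adjacent to the hub.\<close>
          with antichain i obtain w where w: "w \<in> N i" "w \<notin> N j" by blast
          moreover have "w \<in> {1..m}" using N i(1) w by blast
          ultimately show ?thesis
            using i by (intro disjI2 bexI[of _ w]) (auto simp: leaf_graph_def in_symcl_iff)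
        qed
      qed
    qed
  next
    assume conn: "connected (delete_vertices ?G (N j))"
    show "j \<in> S"
    proof (rule ccontr)
      assume "j \<notin> S"
      \<comment> \<open>Without the arc to the hub, all neighbours of leaf \<open>j\<close> lie in
        the deleted set \<open>N j\<close>.\<close>
      then have "(Suc (m + j), w) \<notin> parcs ?G \<and> (w, Suc (m + j)) \<notin> parcs ?G"
        if "w \<in> pverts ?G - N j" for w
        using that N by (force simp: leaf_graph_def in_symcl_iff)
      with conn hub leaf show False
        using not_connected_delete_vertices_isolated[of "Suc (m + j)" ?G "N j" 0] by simp
    qed
  qed
qed

text \<open>Counting: the labels of the ports determine \<open>S\<close>, so the
  \<open>2 ^ n\<close> choices of \<open>S\<close> need as many distinct assignments of
  \<open>b\<close>-bit labels to the \<open>m\<close> ports.\<close>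

lemma labeling_scheme_antichain_bound:
  assumes scheme: "connectivity_labeling_scheme b f B"
    and N: "\<And>j. j < n \<Longrightarrow> N j \<subseteq> {1..m} \<and> N j \<noteq> {} \<and> card (N j) \<le> f"
    and antichain: "\<And>i j. i < n \<Longrightarrow> j < n \<Longrightarrow> N i \<subseteq> N j \<Longrightarrow> i = j"
    and size: "real (Suc (m + n)) \<le> B"
  shows "n \<le> b * m"
proof -
  let ?G = "leaf_graph m n N"
  obtain D where D: "\<forall>G :: nat pair_pre_digraph. pair_graph G \<and> real (card (pverts G)) \<le> B \<longrightarrow>
      (\<exists>L :: nat \<Rightarrow> bool list. (\<forall>v \<in> pverts G. length (L v) = b) \<and>
        (\<forall>F. F \<subseteq> pverts G \<and> F \<noteq> {} \<and> card F \<le> f \<longrightarrow>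
           (D (L ` F) \<longleftrightarrow> connected (delete_vertices G F))))"
    using scheme unfolding connectivity_labeling_scheme_def by (elim exE) (rule that)
  \<comment> \<open>One decoder \<open>D\<close> serves all graphs \<open>?G S\<close>, and only the
    labeling varies with \<open>S\<close>. The injectivity below rests on this order of
    choices.\<close>
  have "\<exists>L :: nat \<Rightarrow> bool list. (\<forall>v \<in> {1..m}. length (L v) = b) \<and>
      (\<forall>j<n. D (L ` N j) \<longleftrightarrow> j \<in> S)" if S: "S \<subseteq> {..<n}" for S
  proof -
    have verts: "pverts (?G S) = {..m + n}" by (simp add: leaf_graph_def)
    have "pair_graph (?G S)"
      using N S by (intro pair_graph_leaf_graph) auto
    moreover have "real (card (pverts (?G S))) \<le> B"
      using size by (simp add: verts)
    ultimately obtain L :: "nat \<Rightarrow> bool list"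
      where len: "\<forall>v \<in> {..m + n}. length (L v) = b"
        and dec: "\<forall>F. F \<subseteq> {..m + n} \<and> F \<noteq> {} \<and> card F \<le> f \<longrightarrow>
          (D (L ` F) \<longleftrightarrow> connected (delete_vertices (?G S) F))"
      using D[rule_format, of "?G S"] unfolding verts by (elim exE conjE meta_impE) auto
    have "D (L ` N j) \<longleftrightarrow> j \<in> S" if "j < n" for j
    proof -
      have "N j \<subseteq> {..m + n}" using N[OF that] by force
      then have "D (L ` N j) \<longleftrightarrow> connected (delete_vertices (?G S) (N j))"
        using N[OF that] by (intro dec[rule_format]) auto
      also have "\<dots> \<longleftrightarrow> j \<in> S"
        using N S that antichain by (intro connected_leaf_graph_delete_iff) auto
      finally show ?thesis .
    qed
    with len show ?thesis by (intro exI[of _ L]) auto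
  qed
  then obtain L :: "nat set \<Rightarrow> nat \<Rightarrow> bool list"
    where len: "\<And>S v. S \<subseteq> {..<n} \<Longrightarrow> v \<in> {1..m} \<Longrightarrow> length (L S v) = b"
      and dec: "\<And>S j. S \<subseteq> {..<n} \<Longrightarrow> j < n \<Longrightarrow> D (L S ` N j) \<longleftrightarrow> j \<in> S"
    by metis
  let ?labels = "{bs :: bool list. length bs = b}"
  \<comment> \<open>Restriction forgets the labels of the hub and the leaves, which no query
    \<open>N j\<close> reads, and puts the labeling into a finite extensional function
    space.\<close>
  let ?port_labels = "\<lambda>S. restrict (L S) {1..m}"
  have finite_labels: "finite ?labels" and card_labels: "card ?labels = 2 ^ b"
    using finite_lists_length_eq[of "UNIV :: bool set" b]
      card_lists_length_eq[of "UNIV :: bool set" b] by simp_all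
  have "inj_on ?port_labels (Pow {..<n})"
  proof (rule inj_onI)
    fix S T assume ST: "S \<in> Pow {..<n}" "T \<in> Pow {..<n}" and eq: "?port_labels S = ?port_labels T"
    have "j \<in> S \<longleftrightarrow> j \<in> T" if j: "j < n" for j
    proof -
      have "L S ` N j = L T ` N j"
      proof (rule image_cong)
        fix v assume "v \<in> N j"
        with N[OF j] have "v \<in> {1..m}" by blast
        with fun_cong[OF eq, of v] show "L S v = L T v" by simp
      qed simp
      with dec[of S j] dec[of T j] ST j show ?thesis by simp
    qed
    with ST show "S = T" by auto
  qed
  moreover have "?port_labels ` Pow {..<n} \<subseteq> {1..m} \<rightarrow>\<^sub>E ?labels"
    using len by auto
  moreover have "finite ({1..m} \<rightarrow>\<^sub>E ?labels)"
    using finite_labels by (intro finite_PiE) auto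
  ultimately have "card (Pow {..<n}) \<le> card ({1..m} \<rightarrow>\<^sub>E ?labels)"
    by (rule card_inj_on_le)
  then have "(2 :: nat) ^ n \<le> 2 ^ (b * m)"
    by (simp add: card_Pow card_PiE card_labels power_mult)
  then show ?thesis
    by simp
qed

text \<open>Group \<open>t\<close> consists of the ports \<open>t * K + 1\<close> to
  \<open>t * K + K\<close>. A set with exactly one port in each group contains another such set only
  if both are equal, and there are \<open>K ^ f\<close> of them.\<close>

lemma transversal_antichain:
  assumes "n \<le> K ^ f" and "f \<ge> 1"
  obtains N :: "nat \<Rightarrow> nat set"
  where "\<And>j. j < n \<Longrightarrow> N j \<subseteq> {1..f * K} \<and> N j \<noteq> {} \<and> card (N j) \<le> f"
    and "\<And>i j. i < n \<Longrightarrow> j < n \<Longrightarrow> N i \<subseteq> N j \<Longrightarrow> i = j"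
proof -
  have "card {..<n} \<le> card ({..<f} \<rightarrow>\<^sub>E {..<K})"
    using assms(1) by (simp add: card_PiE)
  then obtain g where g: "g ` {..<n} \<subseteq> {..<f} \<rightarrow>\<^sub>E {..<K}" and inj: "inj_on g {..<n}"
    using card_le_inj[of "{..<n}" "{..<f} \<rightarrow>\<^sub>E {..<K}"] by (auto simp: finite_PiE)
  have g_less: "g j t < K" if "j < n" "t < f" for j t
    using g that by (force simp: PiE_iff)
  \<comment> \<open>The \<open>Suc\<close> skips 0, the number of the hub.\<close>
  define N where "N j = (\<lambda>t. Suc (t * K + g j t)) ` {..<f}" for j
  have ports: "N j \<subseteq> {1..f * K}" if j: "j < n" for j
  proof -
    have "Suc (t * K + g j t) \<le> f * K" if t: "t < f" for t
    proof -
      have "Suc (t * K + g j t) \<le> Suc t * K" using g_less[OF j t] by simp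
      also have "\<dots> \<le> f * K" using t by (intro mult_right_mono) auto
      finally show ?thesis .
    qed
    then show ?thesis by (auto simp: N_def)
  qed
  have "N j \<noteq> {}" for j
    using assms(2) by (auto simp: N_def lessThan_empty_iff)
  moreover have "card (N j) \<le> f" for j
    using card_image_le[of "{..<f}"] by (simp add: N_def)
  moreover have "i = j" if ij: "i < n" "j < n" and sub: "N i \<subseteq> N j" for i j
  proof -
    have "g i t = g j t" if t: "t < f" for t
    proof -
      have "Suc (t * K + g i t) \<in> N j" using sub t by (auto simp: N_def)
      then obtain s where s: "s < f" "t * K + g i t = s * K + g j s" by (auto simp: N_def)
      \<comment> \<open>Division by \<open>K\<close> recovers the group, so \<open>s = t\<close> and
        both sets choose the same port there.\<close>
      have "(t * K + g i t) div K = t" "(s * K + g j s) div K = s"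
        using g_less[OF ij(1) t] g_less[OF ij(2) s(1)] by auto
      with s(2) show ?thesis by auto
    qed
    moreover have "g i \<in> {..<f} \<rightarrow>\<^sub>E {..<K}" "g j \<in> {..<f} \<rightarrow>\<^sub>E {..<K}"
      using g ij by auto
    \<comment> \<open>Extensional functions that agree on \<open>{..<f}\<close> are equal.\<close>
    ultimately have "g i = g j"
      by (intro PiE_ext) auto
    with inj ij show ?thesis by (auto dest: inj_onD)
  qed
  ultimately show ?thesis
    using ports by (intro that[of N]) auto
qed

theorem mainTheorem13:
  shows "\<exists>C > 0. \<exists>c > 0. \<forall>(n::nat) (f::nat) (b::nat).
           n \<ge> 1 \<and> f \<ge> 1 \<and>
           connectivity_labeling_scheme b f (C * (real n + real f * real n powr (1 / real f)))
           \<longrightarrow> real b \<ge> c * (real n powr (1 - 1 / real f) / real f)"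
proof -
  \<comment> \<open>The constant 2 in the size bound pays for rounding \<open>q\<close> up to
    \<open>K\<close> and for the hub; the same rounding costs the factor \<open>1 / 2\<close> in the
    conclusion.\<close>
  have "real b \<ge> 1 / 2 * (real n powr (1 - 1 / real f) / real f)"
    if n: "n \<ge> 1" and f: "f \<ge> 1"
      and scheme: "connectivity_labeling_scheme b f (2 * (real n + real f * real n powr (1 / real f)))"
    for n f b
  proof -
    define q where "q = real n powr (1 / real f)"
    define K where "K = nat \<lceil>q\<rceil>"
    have q: "1 \<le> q" using n by (simp add: q_def ge_one_powr_ge_zero)
    \<comment> \<open>The upper bound is \<open>K \<le> q + 1 \<le> 2 * q\<close>, by
      \<open>1 \<le> q\<close>.\<close>
    have K: "q \<le> real K" "real K \<le> 2 * q" using q unfolding K_def by linarith+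
    have "real n = q ^ f"
      using n f by (simp add: q_def powr_power)
    also have "\<dots> \<le> real K ^ f"
      using q K by (intro power_mono) auto
    finally have "n \<le> K ^ f"
      by (simp flip: of_nat_power)
    then obtain N :: "nat \<Rightarrow> nat set"
      where N: "\<And>j. j < n \<Longrightarrow> N j \<subseteq> {1..f * K} \<and> N j \<noteq> {} \<and> card (N j) \<le> f"
        and antichain: "\<And>i j. i < n \<Longrightarrow> j < n \<Longrightarrow> N i \<subseteq> N j \<Longrightarrow> i = j"
      using f by (rule transversal_antichain) blast
    have fK: "real (f * K) \<le> 2 * (real f * q)"
      using mult_left_mono[OF K(2), of "real f"] by simp
    \<comment> \<open>The hub is absorbed by \<open>1 + n \<le> 2 * n\<close>.\<close>
    then have "real (Suc (f * K + n)) \<le> 2 * (real n + real f * q)"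
      using n by simp
    with scheme N antichain have "n \<le> b * (f * K)"
      unfolding q_def by (intro labeling_scheme_antichain_bound)
    then have "real n \<le> real b * real (f * K)"
      by (metis of_nat_le_iff of_nat_mult)
    also have "\<dots> \<le> real b * (2 * (real f * q))"
      using fK by (intro mult_left_mono) auto
    finally have "real n / q / real f \<le> 2 * real b"
      using q f by (simp add: field_simps)
    moreover have "real n powr (1 - 1 / real f) = real n / q"
      using n by (simp add: powr_diff q_def)
    ultimately show ?thesis by simp
  qed
  then show ?thesis
    by (intro exI[of _ 2] exI[of _ "1 / 2"] conjI) auto
qed

end
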